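(* For every $r,s>0$, the metric Lie algebra $(\mathfrak g_{r,s},\langle\cdot,\cdot\rangle)$ satisfies $\mathcal{KY}^2(\mathfrak g_{r,s},\langle\cdot,\cdot\rangle)=\mathcal{*KY}^2(\mathfrak g_{r,s},\langle\cdot,\cdot\rangle)=0$, and the space $\mathcal{CKY}^2(\mathfrak g_{r,s},\langle\cdot,\cdot\rangle)$ has dimension one.
   Context: For $r,s>0$, $(\mathfrak g_{r,s},\langle\cdot,\cdot\rangle)$ is the $5$-dimensional real Lie algebra with orthonormal basis $\{\xi,z_1,z_2,x,y\}$ and non-zero brackets (up to skew-symmetry) $[\xi,x]=rz_1+a_4y$, $[\xi,y]=rz_2-a_4x$, $[x,y]=s\xi$, where $a_4=\frac{s^2-r^2}{s}$. On a metric Lie algebra $(\mathfrak g,\langle\cdot,\cdot\rangle)$ (real Lie algebra with inner product), $\nabla$ is given by $2\langle\nabla_uv,w\rangle=\langle[u,v],w\rangle-\langle[v,w],u\rangle+\langle[w,u],v\rangle$, and $(\nabla_uT)v=\nabla_u(Tv)-T(\nabla_uv)$. A $2$-form $\omega\in\Lambda^2\mathfrak g^*$ corresponds to the skew-symmetric endomorphism $T$ with $\omega(u,v)=\langle Tu,v\rangle$. $\omega$ is CKY (conformal Killing-Yano) if there is $\theta\in\mathfrak g^*$ with $\langle(\nabla_uT)v,w\rangle+\langle(\nabla_vT)u,w\rangle=2\langle u,v\rangle\theta(w)-\langle v,w\rangle\theta(u)-\langle u,w\rangle\theta(v)$ for all $u,v,w\in\mathfrak g$; it is KY (Killing-Yano)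 if $\theta=0$, and $*$-KY if it is CKY and closed, $d\omega(u,v,w)=-\omega([u,v],w)-\omega([v,w],u)-\omega([w,u],v)$. $\mathcal{CKY}^2$, $\mathcal{KY}^2$, $\mathcal{*KY}^2$ denote the corresponding vector spaces of $2$-forms in $\Lambda^2\mathfrak g^*$. *)

theory Defs
  imports "HOL-Analysis.Analysis"
begin

locale real_lie_algebra =
  fixes lie :: "'a::real_vector \<Rightarrow> 'a \<Rightarrow> 'a"
  assumes lie_bilinear: "bilinear lie"
    and lie_alternating: "lie u u = 0"
    and lie_jacobi: "lie u (lie v w) + lie v (lie w u) + lie w (lie u v) = 0"

text \<open>
  A metric Lie algebra is a Euclidean space, whose inner product is the metric, together with a
  Lie bracket \<open>lie\<close>.  The notions below depend only on these two data and take \<open>lie\<close> as a parameter.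

  Since the space has finite dimension, every bilinear form is bounded. Bilinear forms are therefore
  represented by bounded linear maps into bounded linear functionals, a type that already is a real
  vector space.
\<close>

type_synonym 'a dual = "'a \<Rightarrow>\<^sub>L real"
type_synonym 'a bilin_form = "'a \<Rightarrow>\<^sub>L 'a \<Rightarrow>\<^sub>L real"

definition two_forms :: "'a::euclidean_space bilin_form set" where
  "two_forms = {\<omega>. \<forall>u. blinfun_apply (blinfun_apply \<omega> u) u = 0}"

text \<open>Levi-Civita connection, defined by the Koszul formula.\<close>

definition nabla :: "('a::euclidean_space \<Rightarrow> 'a \<Rightarrow> 'a) \<Rightarrow> 'a \<Rightarrow> 'a \<Rightarrow> 'a" where
  "nabla lie u v = (THE n. \<forall>w. 2 * (n \<bullet> w) = lie u v \<bullet> w - lie v w \<bullet> u + lie w u \<bullet> v)"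

definition nabla_endo ::
    "('a::euclidean_space \<Rightarrow> 'a \<Rightarrow> 'a) \<Rightarrow> 'a \<Rightarrow> ('a \<Rightarrow> 'a) \<Rightarrow> 'a \<Rightarrow> 'a" where
  "nabla_endo lie u T v = nabla lie u (T v) - T (nabla lie u v)"

definition form_endo :: "'a::euclidean_space bilin_form \<Rightarrow> 'a \<Rightarrow> 'a" where
  "form_endo \<omega> = (THE T. \<forall>u v. blinfun_apply (blinfun_apply \<omega> u) v = T u \<bullet> v)"

definition CKY_equation ::
    "('a::euclidean_space \<Rightarrow> 'a \<Rightarrow> 'a) \<Rightarrow> 'a bilin_form \<Rightarrow> 'a dual \<Rightarrow> bool" where
  "CKY_equation lie \<omega> \<theta> \<longleftrightarrow>
    (\<forall>u v w. nabla_endo lie u (form_endo \<omega>) v \<bullet> w + nabla_endo lie v (form_endo \<omega>) u \<bullet> w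
      = 2 * (u \<bullet> v) * blinfun_apply \<theta> w - (v \<bullet> w) * blinfun_apply \<theta> u
          - (u \<bullet> w) * blinfun_apply \<theta> v)"

definition ext_deriv ::
    "('a::euclidean_space \<Rightarrow> 'a \<Rightarrow> 'a) \<Rightarrow> 'a bilin_form \<Rightarrow> 'a \<Rightarrow> 'a \<Rightarrow> 'a \<Rightarrow> real" where
  "ext_deriv lie \<omega> u v w =
    - blinfun_apply (blinfun_apply \<omega> (lie u v)) w - blinfun_apply (blinfun_apply \<omega> (lie v w)) u
    - blinfun_apply (blinfun_apply \<omega> (lie w u)) v"

definition CKY2 :: "('a::euclidean_space \<Rightarrow> 'a \<Rightarrow> 'a) \<Rightarrow> 'a bilin_form set" where
  "CKY2 lie = {\<omega> \<in> two_forms. \<exists>\<theta>. CKY_equation lie \<omega> \<theta>}"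

definition KY2 :: "('a::euclidean_space \<Rightarrow> 'a \<Rightarrow> 'a) \<Rightarrow> 'a bilin_form set" where
  "KY2 lie = {\<omega> \<in> two_forms. CKY_equation lie \<omega> 0}"

definition star_KY2 :: "('a::euclidean_space \<Rightarrow> 'a \<Rightarrow> 'a) \<Rightarrow> 'a bilin_form set" where
  "star_KY2 lie = {\<omega> \<in> CKY2 lie. \<forall>u v w. ext_deriv lie \<omega> u v w = 0}"

lemma ex1_riesz:
  fixes f :: "'a::euclidean_space \<Rightarrow> real"
  assumes "linear f"
  shows "\<exists>!n. \<forall>w. n \<bullet> w = f w"
proof -
  have "adjoint f 1 \<bullet> w = f w" for w
    using adjoint_works[OF assms, of w 1] by (simp add: inner_commute)
  moreover have "n = m" if "\<forall>w. n \<bullet> w = f w" "\<forall>w. m \<bullet> w = f w" for n m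
    by (rule vector_eq_rdot[THEN iffD1]) (simp add: that)
  ultimately show ?thesis
    by (intro ex1I[of _ "adjoint f 1"]) simp_all
qed

lemma nabla_koszul:
  assumes "bilinear lie"
  shows "2 * (nabla lie u v \<bullet> w) = lie u v \<bullet> w - lie v w \<bullet> u + lie w u \<bullet> v"
proof -
  interpret l: bounded_bilinear lie
    using assms bilinear_conv_bounded_bilinear by blast
  let ?f = "\<lambda>w. (lie u v \<bullet> w - lie v w \<bullet> u + lie w u \<bullet> v) / 2"
  have "linear ?f"
    by (rule linearI)
      (simp_all add: l.add_left l.add_right l.scaleR_left l.scaleR_right inner_add_left
        inner_add_right algebra_simps add_divide_distrib diff_divide_distrib)
  from ex1_riesz[OF this]
  have "\<exists>!n. \<forall>w. 2 * (n \<bullet> w) = lie u v \<bullet> w - lie v w \<bullet> u + lie w u \<bullet> v"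
    by (simp add: field_simps)
  from theI'[OF this] show ?thesis
    unfolding nabla_def by blast
qed

lemma form_endo_inner:
  "form_endo \<omega> u \<bullet> v = blinfun_apply (blinfun_apply \<omega> u) v"
proof -
  have *: "\<exists>!n. \<forall>v. n \<bullet> v = blinfun_apply (blinfun_apply \<omega> u) v" for u
    by (intro ex1_riesz bounded_linear.linear blinfun.bounded_linear_right)
  define S where "S u = (THE n. \<forall>v. n \<bullet> v = blinfun_apply (blinfun_apply \<omega> u) v)" for u
  have S: "S u \<bullet> v = blinfun_apply (blinfun_apply \<omega> u) v" for u v
    using theI'[OF *[of u]] unfolding S_def by blast
  have "\<exists>!T. \<forall>u v. blinfun_apply (blinfun_apply \<omega> u) v = T u \<bullet> v"
  proof (rule ex1I[of _ S])
    show "\<forall>u v. blinfun_apply (blinfun_apply \<omega> u) v = S u \<bullet> v" by (simp add: S)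
  next
    fix T assume "\<forall>u v. blinfun_apply (blinfun_apply \<omega> u) v = T u \<bullet> v"
    then have "\<forall>v. T u \<bullet> v = S u \<bullet> v" for u by (simp add: S)
    then show "T = S" by (intro ext vector_eq_rdot[THEN iffD1])
  qed
  from theI'[OF this, folded form_endo_def] show ?thesis
    by metis
qed

lemma form_endo_skew:
  assumes "\<omega> \<in> two_forms"
  shows "form_endo \<omega> u \<bullet> v = - (u \<bullet> form_endo \<omega> v)"
proof -
  have z: "blinfun_apply (blinfun_apply \<omega> x) x = 0" for x
    using assms by (simp add: two_forms_def)
  have "blinfun_apply (blinfun_apply \<omega> u) v + blinfun_apply (blinfun_apply \<omega> v) u = 0"
    using z[of "u + v"] z[of u] z[of v]
    by (simp add: blinfun.add_left blinfun.add_right)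
  then show ?thesis
    by (simp add: form_endo_inner inner_commute[of u])
qed

lemma form_endo_add: "form_endo (\<omega> + \<eta>) u = form_endo \<omega> u + form_endo \<eta> u"
  by (rule vector_eq_rdot[THEN iffD1])
    (simp add: form_endo_inner inner_add_left blinfun.add_left)

lemma form_endo_scale: "form_endo (c *\<^sub>R \<omega>) u = c *\<^sub>R form_endo \<omega> u"
  by (rule vector_eq_rdot[THEN iffD1])
    (simp add: form_endo_inner blinfun.scaleR_left)

lemma nabla_add:
  assumes "bilinear lie"
  shows "nabla lie u (v + v') = nabla lie u v + nabla lie u v'"
proof (rule vector_eq_rdot[THEN iffD1], rule allI)
  fix w
  interpret l: bounded_bilinear lie
    using assms bilinear_conv_bounded_bilinear by blast
  have "2 * (nabla lie u (v + v') \<bullet> w) = 2 * ((nabla lie u v + nabla lie u v') \<bullet> w)"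
    by (simp add: inner_add_left distrib_left nabla_koszul[OF assms])
      (simp add: l.add_left l.add_right inner_add_left inner_add_right)
  then show "nabla lie u (v + v') \<bullet> w = (nabla lie u v + nabla lie u v') \<bullet> w" by simp
qed

lemma nabla_scale:
  assumes "bilinear lie"
  shows "nabla lie u (c *\<^sub>R v) = c *\<^sub>R nabla lie u v"
proof (rule vector_eq_rdot[THEN iffD1], rule allI)
  fix w
  interpret l: bounded_bilinear lie
    using assms bilinear_conv_bounded_bilinear by blast
  have "2 * (nabla lie u (c *\<^sub>R v) \<bullet> w) = c * (2 * (nabla lie u v \<bullet> w))"
    unfolding nabla_koszul[OF assms]
    by (simp add: l.scaleR_left l.scaleR_right algebra_simps)
  then show "nabla lie u (c *\<^sub>R v) \<bullet> w = (c *\<^sub>R nabla lie u v) \<bullet> w" by simp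
qed

lemma nabla_endo_add:
  assumes "bilinear lie"
  shows "nabla_endo lie u (form_endo (\<omega> + \<eta>)) v
    = nabla_endo lie u (form_endo \<omega>) v + nabla_endo lie u (form_endo \<eta>) v"
  by (simp add: nabla_endo_def form_endo_add nabla_add[OF assms])

lemma nabla_endo_scale:
  assumes "bilinear lie"
  shows "nabla_endo lie u (form_endo (c *\<^sub>R \<omega>)) v = c *\<^sub>R nabla_endo lie u (form_endo \<omega>) v"
  by (simp add: nabla_endo_def form_endo_scale nabla_scale[OF assms] scaleR_diff_right)

lemma CKY_equation_zero:
  assumes "bilinear lie"
  shows "CKY_equation lie 0 0"
  using nabla_endo_scale[OF assms, of _ 0 0] by (simp add: CKY_equation_def)

lemma CKY_equation_add:
  assumes "bilinear lie" "CKY_equation lie \<omega> \<theta>" "CKY_equation lie \<eta> \<zeta>"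
  shows "CKY_equation lie (\<omega> + \<eta>) (\<theta> + \<zeta>)"
  unfolding CKY_equation_def
proof (intro allI)
  fix u v w
  show "nabla_endo lie u (form_endo (\<omega> + \<eta>)) v \<bullet> w + nabla_endo lie v (form_endo (\<omega> + \<eta>)) u \<bullet> w
      = 2 * (u \<bullet> v) * blinfun_apply (\<theta> + \<zeta>) w - (v \<bullet> w) * blinfun_apply (\<theta> + \<zeta>) u
          - (u \<bullet> w) * blinfun_apply (\<theta> + \<zeta>) v"
    using assms(2)[unfolded CKY_equation_def, rule_format, of u v w]
      assms(3)[unfolded CKY_equation_def, rule_format, of u v w]
    by (simp add: nabla_endo_add[OF assms(1)] blinfun.add_left inner_add_left algebra_simps)
qed

lemma CKY_equation_scale:
  assumes "bilinear lie" "CKY_equation lie \<omega> \<theta>"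
  shows "CKY_equation lie (c *\<^sub>R \<omega>) (c *\<^sub>R \<theta>)"
  unfolding CKY_equation_def
proof (intro allI)
  fix u v w
  show "nabla_endo lie u (form_endo (c *\<^sub>R \<omega>)) v \<bullet> w + nabla_endo lie v (form_endo (c *\<^sub>R \<omega>)) u \<bullet> w
      = 2 * (u \<bullet> v) * blinfun_apply (c *\<^sub>R \<theta>) w - (v \<bullet> w) * blinfun_apply (c *\<^sub>R \<theta>) u
          - (u \<bullet> w) * blinfun_apply (c *\<^sub>R \<theta>) v"
    using arg_cong[OF assms(2)[unfolded CKY_equation_def, rule_format, of u v w], of "\<lambda>t. c * t"]
    by (simp add: nabla_endo_scale[OF assms(1)] blinfun.scaleR_left algebra_simps)
qed

lemma subspace_two_forms: "subspace two_forms"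
  by (simp add: subspace_def two_forms_def blinfun.add_left blinfun.scaleR_left)

lemma subspace_CKY2:
  assumes "bilinear lie"
  shows "subspace (CKY2 lie)"
  using subspace_two_forms CKY_equation_zero[OF assms] CKY_equation_add[OF assms]
    CKY_equation_scale[OF assms]
  unfolding subspace_def CKY2_def by blast

lemma subspace_KY2:
  assumes "bilinear lie"
  shows "subspace (KY2 lie)"
proof -
  have "CKY_equation lie (\<omega> + \<eta>) 0" if "CKY_equation lie \<omega> 0" "CKY_equation lie \<eta> 0" for \<omega> \<eta>
    using CKY_equation_add[OF assms that] by simp
  moreover have "CKY_equation lie (c *\<^sub>R \<omega>) 0" if "CKY_equation lie \<omega> 0" for c \<omega>
    using CKY_equation_scale[OF assms that, of c] by simp
  ultimately show ?thesis
    using subspace_two_forms CKY_equation_zero[OF assms]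
    unfolding subspace_def KY2_def by blast
qed

lemma subspace_star_KY2:
  assumes "bilinear lie"
  shows "subspace (star_KY2 lie)"
proof -
  have "subspace {\<omega>. \<forall>u v w. ext_deriv lie \<omega> u v w = 0}"
  proof (rule subspaceI, simp_all, intro allI)
    show "ext_deriv lie 0 u v w = 0" for u v w
      by (simp add: ext_deriv_def)
  next
    fix \<omega> \<eta> assume "\<forall>u v w. ext_deriv lie \<omega> u v w = 0" "\<forall>u v w. ext_deriv lie \<eta> u v w = 0"
    moreover have "ext_deriv lie (\<omega> + \<eta>) u v w = ext_deriv lie \<omega> u v w + ext_deriv lie \<eta> u v w"
      for u v w by (simp add: ext_deriv_def blinfun.add_left)
    ultimately show "\<forall>u v w. ext_deriv lie (\<omega> + \<eta>) u v w = 0" by simp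
  next
    fix c \<omega> assume "\<forall>u v w. ext_deriv lie \<omega> u v w = 0"
    moreover have "ext_deriv lie (c *\<^sub>R \<omega>) u v w = c * ext_deriv lie \<omega> u v w" for u v w
      by (simp add: ext_deriv_def blinfun.scaleR_left algebra_simps)
    ultimately show "\<forall>u v w. ext_deriv lie (c *\<^sub>R \<omega>) u v w = 0" by simp
  qed
  from subspace_inter[OF subspace_CKY2[OF assms] this] show ?thesis
    by (simp add: star_KY2_def Int_def)
qed

text \<open>
  The orthonormal basis of \<open>\<gg>\<^bsub>r,s\<^esub>\<close> is the standard basis of \<open>\<real>\<^sup>5\<close>, in the order
  \<open>\<xi>, z\<^sub>1, z\<^sub>2, x, y\<close>.
\<close>

abbreviation xi :: "real ^ 5" where "xi \<equiv> axis 1 1"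
abbreviation z1 :: "real ^ 5" where "z1 \<equiv> axis 2 1"
abbreviation z2 :: "real ^ 5" where "z2 \<equiv> axis 3 1"
abbreviation x_vec :: "real ^ 5" where "x_vec \<equiv> axis 4 1"
abbreviation y_vec :: "real ^ 5" where "y_vec \<equiv> axis 5 1"

definition a4 :: "real \<Rightarrow> real \<Rightarrow> real" where
  "a4 r s = (s\<^sup>2 - r\<^sup>2) / s"

definition g_bracket :: "real \<Rightarrow> real \<Rightarrow> real ^ 5 \<Rightarrow> real ^ 5 \<Rightarrow> real ^ 5" where
  "g_bracket r s u v =
      (u $ 1 * v $ 4 - u $ 4 * v $ 1) *\<^sub>R (r *\<^sub>R z1 + a4 r s *\<^sub>R y_vec)
    + (u $ 1 * v $ 5 - u $ 5 * v $ 1) *\<^sub>R (r *\<^sub>R z2 - a4 r s *\<^sub>R x_vec)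
    + (u $ 4 * v $ 5 - u $ 5 * v $ 4) *\<^sub>R (s *\<^sub>R xi)"

lemma UNIV_5: "(UNIV :: 5 set) = {1, 2, 3, 4, 5}"
proof -
  have "card {1, 2, 3, 4, 5 :: 5} = card (UNIV :: 5 set)" by simp
  from card_subset_eq[OF finite subset_UNIV this] show ?thesis by simp
qed

lemma forall_5: "(\<forall>i::5. P i) \<longleftrightarrow> P 1 \<and> P 2 \<and> P 3 \<and> P 4 \<and> P 5"
  using UNIV_5 by (metis UNIV_I empty_iff insert_iff)

lemma g_bracket_basis:
  "g_bracket r s xi x_vec = r *\<^sub>R z1 + a4 r s *\<^sub>R y_vec"
  "g_bracket r s xi y_vec = r *\<^sub>R z2 - a4 r s *\<^sub>R x_vec"
  "g_bracket r s x_vec y_vec = s *\<^sub>R xi"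
  "g_bracket r s xi z1 = 0" "g_bracket r s xi z2 = 0" "g_bracket r s z1 z2 = 0"
  "g_bracket r s z1 x_vec = 0" "g_bracket r s z1 y_vec = 0"
  "g_bracket r s z2 x_vec = 0" "g_bracket r s z2 y_vec = 0"
  by (simp_all add: g_bracket_def axis_def)

lemma real_lie_algebra_g: "real_lie_algebra (g_bracket r s)"
proof
  show "bilinear (g_bracket r s)"
    unfolding bilinear_def
    by (intro conjI allI linearI)
      (simp_all add: g_bracket_def vec_eq_iff forall_5 axis_def algebra_simps)
  show "g_bracket r s u u = 0" for u
    by (simp add: g_bracket_def mult.commute)
  show "g_bracket r s u (g_bracket r s v w) + g_bracket r s v (g_bracket r s w u)
      + g_bracket r s w (g_bracket r s u v) = 0" for u v w
    by (simp add: g_bracket_def vec_eq_iff forall_5 axis_def algebra_simps)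
qed

end

theory Submission
  imports Defs
begin

text \<open>
  In the standard basis, the CKY equation is a linear system for the ten components of \<open>\<omega>\<close> and the
  five of \<open>\<theta>\<close>.  A handful of its equations force every component of \<open>\<omega>\<close> to be a fixed multiple of
  \<open>\<theta>(\<xi>)\<close>, so the CKY forms span at most a line and there is no nonzero KY form.  The skew
  endomorphism \<open>cky_endo\<close>, read off from those equations, does solve the whole system, and the
  exterior derivative of its 2-form takes the value \<open>3r\<^sup>3 \<noteq> 0\<close> at \<open>(\<xi>, y, z\<^sub>1)\<close>.
\<close>

text \<open>Skewness of the endomorphism \<open>T\<close> turns -<T(nabla_u v), w> into <nabla_u v,
  T w>. Two uses of the Koszul formula then leave only brackets and inner products.\<close>

lemma nabla_endo_koszul:
  assumes "bilinear lie" and "\<omega> \<in> two_forms"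
  shows "2 * (nabla_endo lie u (form_endo \<omega>) v \<bullet> w) =
      lie u (form_endo \<omega> v) \<bullet> w - lie (form_endo \<omega> v) w \<bullet> u + lie w u \<bullet> form_endo \<omega> v
    + (lie u v \<bullet> form_endo \<omega> w - lie v (form_endo \<omega> w) \<bullet> u + lie (form_endo \<omega> w) u \<bullet> v)"
proof -
  have "nabla_endo lie u (form_endo \<omega>) v \<bullet> w =
      nabla lie u (form_endo \<omega> v) \<bullet> w + nabla lie u v \<bullet> form_endo \<omega> w"
    by (simp add: nabla_endo_def inner_diff_left form_endo_skew[OF assms(2)])
  then show ?thesis
    by (simp add: distrib_left nabla_koszul[OF assms(1)])
qed

lemma inner_5:
  "u \<bullet> v = u $ 1 * v $ 1 + u $ 2 * v $ 2 + u $ 3 * v $ 3 + u $ 4 * v $ 4 + u $ 5 * v $ 5"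
  for u v :: "real ^ 5"
  unfolding inner_vec_def UNIV_5 by simp

lemma g_bracket_nth [simp]:
  "g_bracket r s u v $ 1 = s * (u $ 4 * v $ 5 - u $ 5 * v $ 4)"
  "g_bracket r s u v $ 2 = r * (u $ 1 * v $ 4 - u $ 4 * v $ 1)"
  "g_bracket r s u v $ 3 = r * (u $ 1 * v $ 5 - u $ 5 * v $ 1)"
  "g_bracket r s u v $ 4 = - a4 r s * (u $ 1 * v $ 5 - u $ 5 * v $ 1)"
  "g_bracket r s u v $ 5 = a4 r s * (u $ 1 * v $ 4 - u $ 4 * v $ 1)"
  by (simp_all add: g_bracket_def axis_def)

lemma bilinear_g_bracket: "bilinear (g_bracket r s)"
  by (rule real_lie_algebra.lie_bilinear[OF real_lie_algebra_g])

lemma axis_nth_if: "axis i c $ j = (if j = i then c else 0)"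
  by (simp add: axis_def)

lemma form_endo_nth: "form_endo \<omega> u $ i = blinfun_apply (blinfun_apply \<omega> u) (axis i 1)"
  for \<omega> :: "(real ^ 5) bilin_form"
  by (simp add: cart_eq_inner_axis form_endo_inner)

lemma two_forms_swap:
  assumes "\<omega> \<in> two_forms"
  shows "blinfun_apply (blinfun_apply \<omega> u) v = - blinfun_apply (blinfun_apply \<omega> v) u"
  using form_endo_skew[OF assms, of u v] by (simp add: form_endo_inner inner_commute[of u])

text \<open>Makes a genuine form out of \<open>cky_endo\<close>: in finite dimension
  \<open>T\<close> is bounded, so sending u to the functional <T u, .> is a bounded linear
  map.\<close>

lemma form_of_linear_endo:
  fixes T :: "'a::euclidean_space \<Rightarrow> 'a"
  assumes "linear T"
  obtains \<omega> :: "'a bilin_form" where "\<And>u v. blinfun_apply (blinfun_apply \<omega> u) v = T u \<bullet> v"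
proof
  have "bounded_linear (\<lambda>u. blinfun_inner_left (T u))"
    using bounded_linear_compose[OF bounded_linear_blinfun_inner_left
        linear_conv_bounded_linear[THEN iffD1, OF assms]] .
  then show "blinfun_apply (blinfun_apply (Blinfun (\<lambda>u. blinfun_inner_left (T u))) u) v = T u \<bullet> v"
    for u v
    by (simp add: bounded_linear_Blinfun_apply inner_commute)
qed

lemma two_form_eqI:
  fixes \<omega> \<eta> :: "(real ^ 5) bilin_form"
  assumes "\<omega> \<in> two_forms" "\<eta> \<in> two_forms"
    and "\<And>i j. (i, j) \<in> {(1,2), (1,3), (1,4), (1,5), (2,3), (2,4), (2,5), (3,4), (3,5), (4,5)} \<Longrightarrow>
      blinfun_apply (blinfun_apply \<omega> (axis i 1)) (axis j 1) =
      blinfun_apply (blinfun_apply \<eta> (axis i 1)) (axis j 1)"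
  shows "\<omega> = \<eta>"
proof -
  \<comment> \<open>Skewness of both forms makes \<open>D\<close> symmetric, so the diagonal and the
    ten listed pairs cover all 25 index pairs.\<close>
  define D where "D i j \<longleftrightarrow> blinfun_apply (blinfun_apply \<omega> (axis i 1)) (axis j 1) =
      blinfun_apply (blinfun_apply \<eta> (axis i 1)) (axis j 1)" for i j
  have diag: "D i i" for i
    using assms(1,2) by (simp add: D_def two_forms_def)
  have sym: "D j i" if "D i j" for i j
    using that two_forms_swap[OF assms(1)] two_forms_swap[OF assms(2)] unfolding D_def by metis
  have upper: "D 1 2" "D 1 3" "D 1 4" "D 1 5" "D 2 3" "D 2 4" "D 2 5" "D 3 4" "D 3 5" "D 4 5"
    unfolding D_def by (rule assms(3); simp)+
  have "\<forall>i j. D i j"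
    unfolding forall_5 by (intro conjI diag upper upper[THEN sym])
  then show ?thesis
    by (intro blinfun_euclidean_eqI) (auto simp: Basis_vec_def D_def)
qed

text \<open>Ten instances of the equation on basis vectors are enough: they determine the ten
  components \<open>W i j\<close> with i < j through \<open>t\<close> alone.\<close>

lemma CKY_equation_components:
  fixes r s :: real
  assumes "\<omega> \<in> two_forms" and "CKY_equation (g_bracket r s) \<omega> \<theta>"
    and "r > 0" and "s > 0"
  defines "W \<equiv> \<lambda>i j. blinfun_apply (blinfun_apply \<omega> (axis i 1)) (axis j 1)"
    and "t \<equiv> blinfun_apply \<theta> xi"
  shows "W 1 2 = 0" "W 1 3 = 0" "W 1 4 = 0" "W 1 5 = 0" "W 2 5 = 0" "W 3 4 = 0"
    "r * W 2 4 = 2 * t" "r * W 3 5 = 2 * t" "s * W 4 5 = 4 * t" "r * W 2 3 = r * W 4 5 + s * W 2 4"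
proof -
  have sw: "W j i = - W i j" for i j
    unfolding W_def by (rule two_forms_swap[OF assms(1)])
  have W0: "W i i = 0" for i
    using sw[of i i] by simp
  have T: "form_endo \<omega> (axis i 1) $ j = W i j" for i j
    by (simp add: form_endo_nth W_def)
  \<comment> \<open>Doubled to match the factor 2 in \<open>nabla_endo_koszul\<close>.\<close>
  have E: "2 * (nabla_endo (g_bracket r s) (axis i 1) (form_endo \<omega>) (axis j 1) \<bullet> axis k 1)
      + 2 * (nabla_endo (g_bracket r s) (axis j 1) (form_endo \<omega>) (axis i 1) \<bullet> axis k 1)
    = 2 * (2 * (axis i 1 \<bullet> (axis j 1 :: real ^ 5)) * blinfun_apply \<theta> (axis k 1)
          - (axis j 1 \<bullet> (axis k 1 :: real ^ 5)) * blinfun_apply \<theta> (axis i 1)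
          - (axis i 1 \<bullet> (axis k 1 :: real ^ 5)) * blinfun_apply \<theta> (axis j 1))" for i j k
    using assms(2)[unfolded CKY_equation_def, rule_format, of "axis i 1" "axis j 1" "axis k 1"]
    by simp
  \<comment> \<open>Only the instances of \<open>sw\<close> with first index larger than the second:
    they normalise to i < j, whereas the general rule would loop.\<close>
  note [simp] = T W0 sw[of 2 1] sw[of 3 1] sw[of 4 1] sw[of 5 1] sw[of 3 2] sw[of 4 2] sw[of 5 2]
    sw[of 4 3] sw[of 5 3] sw[of 5 4]
  note E = E[unfolded nabla_endo_koszul[OF bilinear_g_bracket assms(1)]]
  \<comment> \<open>The indices in each triple are distinct, so the right-hand sides vanish. In the
    order listed, each equation reduces to \<open>r\<close> times one of these components being
    0.\<close>
  have "W 1 2 = 0 \<and> W 1 3 = 0 \<and> W 1 4 = 0 \<and> W 1 5 = 0 \<and> W 2 5 = 0 \<and> W 3 4 = 0"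
    using E[of 2 3 5] E[of 2 3 4] E[of 4 5 3] E[of 4 5 2] E[of 1 5 4] E[of 1 4 5] assms(3,4)
    by (simp add: inner_5 axis_nth_if flip: t_def)
  then show "W 1 2 = 0" "W 1 3 = 0" "W 1 4 = 0" "W 1 5 = 0" "W 2 5 = 0" "W 3 4 = 0"
    by simp_all
  show w24: "r * W 2 4 = 2 * t"
    using E[of 1 2 2] by (simp add: inner_5 axis_nth_if t_def)
  show "r * W 3 5 = 2 * t"
    using E[of 1 3 3] by (simp add: inner_5 axis_nth_if t_def)
  \<comment> \<open>At (\<xi>, x, x) the terms with \<open>a4\<close> cancel in pairs, leaving
    \<open>r * W 2 4 - s * W 4 5 = - 2 * t\<close>.\<close>
  show "s * W 4 5 = 4 * t"
    using E[of 1 4 4] w24 by (simp add: inner_5 axis_nth_if t_def)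
  show "r * W 2 3 = r * W 4 5 + s * W 2 4"
    using E[of 2 5 1] by (simp add: inner_5 axis_nth_if)
qed

text \<open>The solution of the ten relations normalised by \<open>t = r\<^sup>2 * s / 2\<close>,
  which clears all denominators.\<close>

definition cky_endo :: "real \<Rightarrow> real \<Rightarrow> real ^ 5 \<Rightarrow> real ^ 5" where
  "cky_endo r s u =
    - ((2 * r\<^sup>2 + s\<^sup>2) * u $ 3 + r * s * u $ 4) *\<^sub>R z1
    + ((2 * r\<^sup>2 + s\<^sup>2) * u $ 2 - r * s * u $ 5) *\<^sub>R z2
    + (r * s * u $ 2 - 2 * r\<^sup>2 * u $ 5) *\<^sub>R x_vec
    + (r * s * u $ 3 + 2 * r\<^sup>2 * u $ 4) *\<^sub>R y_vec"

lemma cky_endo_nth [simp]: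
  "cky_endo r s u $ 1 = 0"
  "cky_endo r s u $ 2 = - ((2 * r\<^sup>2 + s\<^sup>2) * u $ 3 + r * s * u $ 4)"
  "cky_endo r s u $ 3 = (2 * r\<^sup>2 + s\<^sup>2) * u $ 2 - r * s * u $ 5"
  "cky_endo r s u $ 4 = r * s * u $ 2 - 2 * r\<^sup>2 * u $ 5"
  "cky_endo r s u $ 5 = r * s * u $ 3 + 2 * r\<^sup>2 * u $ 4"
  by (simp_all add: cky_endo_def axis_nth_if)

lemma linear_cky_endo: "linear (cky_endo r s)"
  by (rule linearI) (simp_all add: vec_eq_iff forall_5 algebra_simps)

text \<open>The value of \<open>a4\<close> is decisive here: given the relations above, the equation
  at (\<xi>, \<open>z1\<close>, y) holds with nonzero \<open>t\<close> exactly when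
  \<open>s * (s - a4 r s) = r\<^sup>2\<close>.\<close>

lemma CKY_equation_cky_endo:
  assumes "s > 0" and \<omega>: "\<And>u v. blinfun_apply (blinfun_apply \<omega> u) v = cky_endo r s u \<bullet> v"
  shows "\<omega> \<in> two_forms"
    and "CKY_equation (g_bracket r s) \<omega> ((r\<^sup>2 * s / 2) *\<^sub>R blinfun_inner_left xi)"
proof -
  show two: "\<omega> \<in> two_forms"
    by (simp add: two_forms_def \<omega> inner_5 algebra_simps)
  have T: "form_endo \<omega> = cky_endo r s"
    by (rule ext, rule vector_eq_rdot[THEN iffD1]) (simp add: form_endo_inner \<omega>)
  \<comment> \<open>In terms of \<open>k\<close> and \<open>s\<close> both \<open>r\<close> and \<open>a\<^sub>4\<close> are polynomials, so \<open>key\<close> becomes a ring identity.\<close>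
  define k where "k = r / s"
  have r: "r = k * s" and a: "a4 r s = s - k\<^sup>2 * s"
    using assms(1) by (simp_all add: k_def a4_def field_simps power2_eq_square)
  have key: "2 * (nabla_endo (g_bracket r s) u (form_endo \<omega>) v \<bullet> w)
      + 2 * (nabla_endo (g_bracket r s) v (form_endo \<omega>) u \<bullet> w)
    = r\<^sup>2 * s * (2 * (u \<bullet> v) * w $ 1 - (v \<bullet> w) * u $ 1 - (u \<bullet> w) * v $ 1)" for u v w
    unfolding nabla_endo_koszul[OF bilinear_g_bracket two] unfolding T
    by (simp add: inner_5 a) (simp add: r algebra_simps power2_eq_square)
  show "CKY_equation (g_bracket r s) \<omega> ((r\<^sup>2 * s / 2) *\<^sub>R blinfun_inner_left xi)"
    unfolding CKY_equation_def
  proof (intro allI)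
    fix u v w
    show "nabla_endo (g_bracket r s) u (form_endo \<omega>) v \<bullet> w
        + nabla_endo (g_bracket r s) v (form_endo \<omega>) u \<bullet> w
      = 2 * (u \<bullet> v) * ((r\<^sup>2 * s / 2) *\<^sub>R blinfun_inner_left xi) w
        - (v \<bullet> w) * ((r\<^sup>2 * s / 2) *\<^sub>R blinfun_inner_left xi) u
        - (u \<bullet> w) * ((r\<^sup>2 * s / 2) *\<^sub>R blinfun_inner_left xi) v"
      using key[of u v w] by (simp add: blinfun.scaleR_left inner_axis algebra_simps)
  qed
qed

text \<open>All components are linear in \<theta>(\<xi>), so the factor is the ratio of
  \<theta>(\<xi>) to the value \<open>r\<^sup>2 * s / 2\<close> that belongs to \<eta>.\<close>

lemma CKY2_eq_multiple:
  fixes r s :: real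
  assumes pos: "r > 0" "s > 0"
    and \<omega>: "\<omega> \<in> two_forms" "CKY_equation (g_bracket r s) \<omega> \<theta>"
    and \<eta>: "\<And>u v. blinfun_apply (blinfun_apply \<eta> u) v = cky_endo r s u \<bullet> v"
  shows "\<omega> = (2 * blinfun_apply \<theta> xi / (r\<^sup>2 * s)) *\<^sub>R \<eta>"
proof (rule two_form_eqI)
  show "\<omega> \<in> two_forms" by fact
  show "(2 * blinfun_apply \<theta> xi / (r\<^sup>2 * s)) *\<^sub>R \<eta> \<in> two_forms"
    using CKY_equation_cky_endo(1)[OF pos(2) \<eta>] subspace_two_forms subspace_scale by blast
next
  fix i j :: 5
  note W = CKY_equation_components[OF \<omega> pos]
  assume "(i, j) \<in> {(1,2), (1,3), (1,4), (1,5), (2,3), (2,4), (2,5), (3,4), (3,5), (4,5)}"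
  moreover have w24: "blinfun_apply (blinfun_apply \<omega> z1) x_vec = 2 * blinfun_apply \<theta> xi / r"
    and "blinfun_apply (blinfun_apply \<omega> z2) y_vec = 2 * blinfun_apply \<theta> xi / r"
    and w45: "blinfun_apply (blinfun_apply \<omega> x_vec) y_vec = 4 * blinfun_apply \<theta> xi / s"
    using W(7-9) pos by (simp_all add: field_simps)
  moreover have "blinfun_apply (blinfun_apply \<omega> z1) z2 =
      blinfun_apply (blinfun_apply \<omega> x_vec) y_vec + s * blinfun_apply (blinfun_apply \<omega> z1) x_vec / r"
    using W(10) pos by (simp add: field_simps)
  then have "blinfun_apply (blinfun_apply \<omega> z1) z2 =
      2 * blinfun_apply \<theta> xi / (r\<^sup>2 * s) * (2 * r\<^sup>2 + s\<^sup>2)"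
    using pos unfolding w24 w45 by (simp add: field_simps power2_eq_square)
  ultimately show "blinfun_apply (blinfun_apply \<omega> (axis i 1)) (axis j 1) =
      blinfun_apply (blinfun_apply ((2 * blinfun_apply \<theta> xi / (r\<^sup>2 * s)) *\<^sub>R \<eta>) (axis i 1)) (axis j 1)"
    using W(1-6) pos
    by (elim insertE emptyE)
      (simp_all add: blinfun.scaleR_left \<eta> inner_5 axis_nth_if power2_eq_square)
qed

theorem theorem6p5:
  fixes r s :: real
  assumes "r > 0" and "s > 0"
  shows "KY2 (g_bracket r s) = {0} \<and> star_KY2 (g_bracket r s) = {0} \<and>
    dim (CKY2 (g_bracket r s)) = 1"
proof (intro conjI)
  obtain \<eta> where \<eta>: "\<And>u v. blinfun_apply (blinfun_apply \<eta> u) v = cky_endo r s u \<bullet> v"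
    using form_of_linear_endo[OF linear_cky_endo] by blast
  note multiple = CKY2_eq_multiple[OF assms _ _ \<eta>]
  have zero: "0 \<in> KY2 (g_bracket r s)" "0 \<in> star_KY2 (g_bracket r s)"
    using subspace_KY2[OF bilinear_g_bracket] subspace_star_KY2[OF bilinear_g_bracket]
    by (auto intro: subspace_0)
  \<comment> \<open>For \<theta> = 0 the factor in \<open>multiple\<close> is 0.\<close>
  have "\<omega> = 0" if "\<omega> \<in> KY2 (g_bracket r s)" for \<omega>
    using that multiple[of \<omega> 0] by (simp add: KY2_def)
  with zero(1) show "KY2 (g_bracket r s) = {0}" by blast
  have "\<omega> = 0" if "\<omega> \<in> star_KY2 (g_bracket r s)" for \<omega>
  proof -
    from that obtain c where c: "\<omega> = c *\<^sub>R \<eta>"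
      using multiple by (auto simp: star_KY2_def CKY2_def)
    \<comment> \<open>As \<open>z1\<close> is central, only the bracket of \<xi> and y contributes
      to the derivative, giving \<open>r * (2 * r\<^sup>2 + s\<^sup>2) - r * s * a4 r s\<close>.
      This identity for \<open>a4\<close> turns that into \<open>3 * r ^ 3\<close>, so closedness
      forces \<open>c = 0\<close>.\<close>
    have "s * a4 r s = s\<^sup>2 - r\<^sup>2"
      using assms by (simp add: a4_def)
    then have "ext_deriv (g_bracket r s) \<eta> xi y_vec z1 = 3 * r ^ 3"
      by (simp add: ext_deriv_def \<eta> inner_5 axis_nth_if) algebra
    moreover have "ext_deriv (g_bracket r s) (c *\<^sub>R \<eta>) xi y_vec z1
        = c * ext_deriv (g_bracket r s) \<eta> xi y_vec z1"
      by (simp add: ext_deriv_def blinfun.scaleR_left algebra_simps)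
    ultimately show ?thesis
      using that c assms by (simp add: star_KY2_def)
  qed
  with zero(2) show "star_KY2 (g_bracket r s) = {0}" by blast
  have "blinfun_apply (blinfun_apply \<eta> x_vec) y_vec = 2 * r\<^sup>2"
    by (simp add: \<eta> inner_5 axis_nth_if)
  with assms have "\<eta> \<noteq> 0" by auto
  have "\<eta> \<in> CKY2 (g_bracket r s)"
    using CKY_equation_cky_endo[OF assms(2) \<eta>] by (auto simp: CKY2_def)
  moreover have "CKY2 (g_bracket r s) \<subseteq> span {\<eta>}"
    using multiple by (auto simp: CKY2_def span_singleton)
  ultimately show "dim (CKY2 (g_bracket r s)) = 1"
    using \<open>\<eta> \<noteq> 0\<close> by (intro dim_unique[of "{\<eta>}"]) auto
qed

end
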